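(* Let $\mathcal{A}\in\mathbb{R}^{n_1\times\cdots\times n_d}$ be an order-$d$ real tensor, $N=n_1+\cdots+n_d$, and let $x\in\mathbb{R}^N$ be partitioned as $x=\begin{bmatrix}u_1\\ \vdots\\ u_d\end{bmatrix}$ with $u_k\in\mathbb{R}^{n_k}$. If $\nabla\phi_{\mathcal{A}}^{(sym)}(x)=0$ and $x^Tx=1$, then either $\mathcal{A}_{(k)}\tilde u_k=0$ for all $k=1,\ldots,d$, or $$\begin{bmatrix}\mathcal{A}_{(1)}\tilde u_1\\ \vdots\\ \mathcal{A}_{(d)}\tilde u_d\end{bmatrix} = d\cdot\phi_{\mathcal{A}}^{(sym)}(x)\begin{bmatrix}u_1\\ \vdots\\ u_d\end{bmatrix}\quad\text{and}\quad \|u_1\|_2=\|u_2\|_2=\cdots=\|u_d\|_2=\frac{1}{\sqrt d}.$$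
   Context: An order-$d$ tensor $\mathcal{A}\in\mathbb{R}^{n_1\times\cdots\times n_d}$ is a real $d$-dimensional array with entries $\mathcal{A}(\mathbf{i})=\mathcal{A}(i_1,\ldots,i_d)$, $1\le i_k\le n_k$. Transposition: for a permutation $\mathbf{p}=[p_1,\ldots,p_d]$ of $1,\ldots,d$, $\mathcal{A}^{<\mathbf{p}>}\in\mathbb{R}^{n_{p_1}\times\cdots\times n_{p_d}}$ is defined by $\mathcal{A}^{<\mathbf{p}>}(j_{p_1},\ldots,j_{p_d})=\mathcal{A}(j_1,\ldots,j_d)$ for $1\le j_k\le n_k$. Symmetric embedding: let $N=n_1+\cdots+n_d$ and partition the index range $1,\ldots,N$ into consecutive ranges $\mathbf{r}_1,\ldots,\mathbf{r}_d$ with $\mathbf{r}_k = (1+n_1+\cdots+n_{k-1}),\ldots,(n_1+\cdots+n_k)$. Then $\mathcal{C}=\mathbf{sym}(\mathcal{A})$ is the order-$d$ tensor in $\mathbb{R}^{N\times\cdots\times N}$ whose blocks $\mathcal{C}_{\mathbf{i}}=\mathcal{C}(\mathbf{r}_{i_1},\ldots,\mathbf{r}_{i_d})$, $1\le i_k\le d$, are $\mathcal{C}_{\mathbf{i}}=\mathcal{A}^{<\mathbf{i}>}$ if $\mathbf{i}=[i_1,\ldots,i_d]$ is a permutation of $1,\ldots,d$, and $\mathcal{C}_{\mathbf{i}}=0$ otherwise. Symmetric Rayleigh quotient: with $\mathcal{C}=\mathbf{sym}(\mathcal{A})$, for nonzero $x\in\mathbb{R}^N$, $$\phi_{\mathcal{A}}^{(sym)}(x)=\frac{1}{d!}\left(\sum_{i_1=1}^N\cdots\sum_{i_d=1}^N\mathcal{C}(i_1,\ldots,i_d)x(i_1)\cdots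 x(i_d)\right)\Big/\|x\|_2^{d}.$$ Modal unfolding: for index vectors $\mathbf{i},\mathbf{s}$ of length $e$, $ivec(\mathbf{i},\mathbf{s})=i_1+(i_2-1)s_1+\cdots+(i_e-1)(s_1\cdots s_{e-1})$. The mode-$k$ unfolding $\mathcal{A}_{(k)}$ is the matrix with $n_k$ rows and $\prod_{j\ne k}n_j$ columns given by $\mathcal{A}_{(k)}(i_k,ivec(\tilde{\mathbf{i}},\tilde{\mathbf{n}}))=\mathcal{A}(\mathbf{i})$, where $\tilde{\mathbf{i}},\tilde{\mathbf{n}}$ are $\mathbf{i}=[i_1,\ldots,i_d]$, $\mathbf{n}=[n_1,\ldots,n_d]$ with the $k$-th entry deleted. For vectors $u_k\in\mathbb{R}^{n_k}$, $\tilde u_k = u_d\otimes\cdots\otimes u_{k+1}\otimes u_{k-1}\otimes\cdots\otimes u_1$ (Kronecker product). *)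

theory Defs
  imports Complex_Main "Jordan_Normal_Form.Matrix"
begin

text \<open>
  All indices (of modes, entries, vectors, matrices and blocks) start at 0, as in the matrix library.
  The values of \<open>entry A\<close> outside the index range of \<open>dims A\<close> carry no meaning; no in-range
  entry of a tensor or matrix defined below depends on them.
\<close>

datatype tensor = Tensor (dims: "nat list") (entry: "nat list \<Rightarrow> real")

definition tensor_order :: "tensor \<Rightarrow> nat" where
  "tensor_order A = length (dims A)"

definition index_range :: "nat list \<Rightarrow> nat list set" where
  "index_range ns = {i. list_all2 (<) i ns}"

definition is_permutation :: "nat \<Rightarrow> nat list \<Rightarrow> bool" where
  "is_permutation d p \<longleftrightarrow> length p = d \<and> distinct p \<and> set p = {..<d}"

text \<open>
  The entry of the transpose at \<open>i = [j ! (p ! 0), \<dots>, j ! (p ! (d - 1))]\<close> is the entry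
  of \<open>A\<close> at \<open>j\<close>; for a permutation \<open>p\<close> the list \<open>j\<close> is determined by \<open>i\<close>
  (lemma \<open>entry_tensor_transpose\<close>).
\<close>

definition tensor_transpose :: "tensor \<Rightarrow> nat list \<Rightarrow> tensor" where
  "tensor_transpose A p =
     Tensor (map (\<lambda>k. dims A ! k) p)
       (\<lambda>i. entry A (THE j. length j = length p \<and> map (\<lambda>k. j ! k) p = i))"

text \<open>The \<open>b\<close>-th index block is the range from \<open>block_start ns b\<close> to
  \<open>block_start ns (Suc b) - 1\<close>.\<close>

definition block_start :: "nat list \<Rightarrow> nat \<Rightarrow> nat" where
  "block_start ns b = sum_list (take b ns)"

definition block_of :: "nat list \<Rightarrow> nat \<Rightarrow> nat" where
  "block_of ns c =
     (THE b. b < length ns \<and> block_start ns b \<le> c \<and> c < block_start ns (Suc b))"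

text \<open>
  An entry of the symmetric embedding is located by the block multi-index \<open>b\<close> containing it
  and by its position \<open>l\<close> within that block (lemma \<open>entry_sym_embed\<close>).
\<close>

definition sym_embed :: "tensor \<Rightarrow> tensor" where
  "sym_embed A =
     (let ns = dims A; d = tensor_order A in
      Tensor (replicate d (sum_list ns))
        (\<lambda>c. let b = map (block_of ns) c;
                 l = map (\<lambda>m. m - block_start ns (block_of ns m)) c
             in if is_permutation d b then entry (tensor_transpose A b) l else 0))"

definition norm2 :: "real vec \<Rightarrow> real" where
  "norm2 x = sqrt (x \<bullet> x)"

definition sym_rayleigh :: "tensor \<Rightarrow> real vec \<Rightarrow> real" where
  "sym_rayleigh A x =
     (let C = sym_embed A; d = tensor_order A in
      1 / fact d * (\<Sum>i\<in>index_range (dims C). entry C i * (\<Prod>k<d. x $ (i ! k))) / norm2 x ^ d)"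

text \<open>The gradient as the vector of partial derivatives, all of which are required to exist.\<close>

definition has_gradient :: "(real vec \<Rightarrow> real) \<Rightarrow> real vec \<Rightarrow> real vec \<Rightarrow> bool" where
  "has_gradient f g x \<longleftrightarrow>
     dim_vec g = dim_vec x \<and>
     (\<forall>i<dim_vec x.
        ((\<lambda>t. f (x + t \<cdot>\<^sub>v unit_vec (dim_vec x) i)) has_real_derivative g $ i) (at 0))"

definition delete_nth :: "nat \<Rightarrow> 'a list \<Rightarrow> 'a list" where
  "delete_nth k xs = take k xs @ drop (Suc k) xs"

definition ivec :: "nat list \<Rightarrow> nat list \<Rightarrow> nat" where
  "ivec i s = (\<Sum>m<length i. i ! m * prod_list (take m s))"

text \<open>The multi-index \<open>i\<close> is determined by row and column (lemma \<open>index_unfolding\<close>).\<close>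

definition unfolding_mat :: "tensor \<Rightarrow> nat \<Rightarrow> real mat" where
  "unfolding_mat A k =
     mat (dims A ! k) (prod_list (delete_nth k (dims A)))
       (\<lambda>(r, c). entry A (THE i. i \<in> index_range (dims A) \<and> i ! k = r \<and>
                               ivec (delete_nth k i) (delete_nth k (dims A)) = c))"

definition kron :: "real vec \<Rightarrow> real vec \<Rightarrow> real vec" where
  "kron u v =
     vec (dim_vec u * dim_vec v) (\<lambda>i. u $ (i div dim_vec v) * v $ (i mod dim_vec v))"

text \<open>The product runs from the last vector down to the first; the empty product is the vector
  with the single entry 1.\<close>

definition kron_except :: "real vec list \<Rightarrow> nat \<Rightarrow> real vec" where
  "kron_except us k = foldr kron (rev (delete_nth k us)) (vec 1 (\<lambda>_. 1))"

definition stack :: "real vec list \<Rightarrow> real vec" where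
  "stack us = foldr (@\<^sub>v) us vNil"

subsection \<open>The defining equations determine all entries\<close>

lemma finite_index_range: "finite (index_range ns)"
proof (rule finite_subset)
  show "index_range ns \<subseteq> {xs. set xs \<subseteq> {..sum_list ns} \<and> length xs = length ns}"
  proof (clarsimp simp: index_range_def list_all2_lengthD)
    fix xs x assume a: "list_all2 (<) xs ns" and "x \<in> set xs"
    then obtain k where k: "k < length xs" "x = xs ! k" by (auto simp: in_set_conv_nth)
    then have "x < ns ! k" "ns ! k \<in> set ns" using a by (auto simp: list_all2_conv_all_nth)
    then show "x \<le> sum_list ns" using member_le_sum_list[of "ns ! k" ns] by simp
  qed
  show "finite {xs. set xs \<subseteq> {..sum_list ns} \<and> length xs = length ns}"
    by (rule finite_lists_length_eq) simp
qed

lemma entry_tensor_transpose: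
  assumes "is_permutation d p" "length j = d"
  shows "entry (tensor_transpose A p) (map (\<lambda>k. j ! k) p) = entry A j"
proof -
  have "(THE j'. length j' = length p \<and> map (\<lambda>k. j' ! k) p = map (\<lambda>k. j ! k) p) = j"
  proof (rule the_equality)
    show "length j = length p \<and> map (\<lambda>k. j ! k) p = map (\<lambda>k. j ! k) p"
      using assms by (simp add: is_permutation_def)
    fix j' assume "length j' = length p \<and> map (\<lambda>k. j' ! k) p = map (\<lambda>k. j ! k) p"
    then show "j' = j" using assms by (auto simp: is_permutation_def intro!: nth_equalityI)
  qed
  then show ?thesis by (simp add: tensor_transpose_def)
qed

lemma block_start_Suc:
  "b < length ns \<Longrightarrow> block_start ns (Suc b) = block_start ns b + ns ! b"
  by (simp add: block_start_def take_Suc_conv_app_nth)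

lemma block_start_mono: "a \<le> b \<Longrightarrow> block_start ns a \<le> block_start ns b"
  by (metis block_start_def le_add1 le_add_diff_inverse sum_list_append take_add)

lemma block_of_eq:
  assumes "b < length ns" "l < ns ! b"
  shows "block_of ns (block_start ns b + l) = b"
  unfolding block_of_def
proof (rule the_equality)
  show "b < length ns \<and> block_start ns b \<le> block_start ns b + l \<and>
    block_start ns b + l < block_start ns (Suc b)"
    using assms by (simp add: block_start_Suc)
  fix a assume a: "a < length ns \<and> block_start ns a \<le> block_start ns b + l \<and>
    block_start ns b + l < block_start ns (Suc a)"
  show "a = b"
  proof (rule ccontr)
    assume "a \<noteq> b"
    then consider "Suc a \<le> b" | "Suc b \<le> a" by linarith
    then show False
      by cases (use a assms block_start_mono[of "Suc a" b ns] block_start_mono[of "Suc b" a ns]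
          block_start_Suc[of b ns] in auto)
  qed
qed

lemma entry_sym_embed:
  assumes "length b = tensor_order A" "\<forall>k<length b. b ! k < tensor_order A"
    and "l \<in> index_range (map (\<lambda>k. dims A ! k) b)"
  shows "entry (sym_embed A) (map2 (\<lambda>a m. block_start (dims A) a + m) b l) =
     (if is_permutation (tensor_order A) b then entry (tensor_transpose A b) l else 0)"
proof -
  let ?c = "map2 (\<lambda>a m. block_start (dims A) a + m) b l"
  have len: "length l = length b" and lt: "\<And>k. k < length b \<Longrightarrow> l ! k < dims A ! (b ! k)"
    using assms(3) by (auto simp: index_range_def list_all2_conv_all_nth)
  have "map (block_of (dims A)) ?c = b"
    using assms len lt by (auto intro!: nth_equalityI simp: block_of_eq tensor_order_def)
  moreover have "map (\<lambda>m. m - block_start (dims A) (block_of (dims A) m)) ?c = l"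
    using assms len lt by (auto intro!: nth_equalityI simp: block_of_eq tensor_order_def)
  ultimately show ?thesis by (simp add: sym_embed_def Let_def)
qed

lemma ivec_Cons: "ivec (a # i) (n # s) = a + n * ivec i s"
  unfolding ivec_def length_Cons sum.lessThan_Suc_shift
  by (simp add: sum_distrib_left ac_simps)

lemma ivec_less: "list_all2 (<) i s \<Longrightarrow> ivec i s < prod_list s"
proof (induction rule: list_all2_induct)
  case Nil then show ?case by (simp add: ivec_def)
next
  case (Cons a i n s)
  then have "a + n * ivec i s < n * Suc (ivec i s)" by simp
  also have "\<dots> \<le> n * prod_list s" using Cons by (intro mult_le_mono2) simp
  finally show ?case by (simp add: ivec_Cons)
qed

lemma ivec_inj:
  "list_all2 (<) i s \<Longrightarrow> list_all2 (<) j s \<Longrightarrow> ivec i s = ivec j s \<Longrightarrow> i = j"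
proof (induction s arbitrary: i j)
  case (Cons n s)
  obtain a i' b j' where ij: "i = a # i'" "j = b # j'" "a < n" "b < n"
    "list_all2 (<) i' s" "list_all2 (<) j' s"
    using Cons.prems by (auto simp: list_all2_Cons2)
  have e: "a + n * ivec i' s = b + n * ivec j' s" using Cons.prems ij by (simp add: ivec_Cons)
  have "a = b" using arg_cong[OF e, of "\<lambda>x. x mod n"] ij by simp
  moreover have "ivec i' s = ivec j' s" using e calculation ij by simp
  ultimately show ?case using Cons.IH ij by blast
qed simp

lemma delete_nth_less:
  "list_all2 (<) i s \<Longrightarrow> list_all2 (<) (delete_nth k i) (delete_nth k s)"
  unfolding delete_nth_def
  by (intro list_all2_appendI list_all2_takeI list_all2_dropI)

lemma index_unfolding:
  assumes "i \<in> index_range (dims A)" "k < tensor_order A"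
  shows "unfolding_mat A k $$ (i ! k, ivec (delete_nth k i) (delete_nth k (dims A))) = entry A i"
proof -
  let ?s = "delete_nth k (dims A)"
  have i: "list_all2 (<) i (dims A)" using assms by (simp add: index_range_def)
  have k: "k < length (dims A)" using assms by (simp add: tensor_order_def)
  have "(THE j. j \<in> index_range (dims A) \<and> j ! k = i ! k \<and>
          ivec (delete_nth k j) ?s = ivec (delete_nth k i) ?s) = i"
  proof (rule the_equality)
    fix j assume j: "j \<in> index_range (dims A) \<and> j ! k = i ! k \<and>
          ivec (delete_nth k j) ?s = ivec (delete_nth k i) ?s"
    then have j': "list_all2 (<) j (dims A)" by (simp add: index_range_def)
    have l: "length j = length i" using i j' by (simp add: list_all2_lengthD)
    have "delete_nth k j = delete_nth k i"
      using j delete_nth_less[OF i] delete_nth_less[OF j'] ivec_inj by blast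
    then have "take k j = take k i" "drop (Suc k) j = drop (Suc k) i"
      using l by (simp_all add: delete_nth_def)
    moreover have "k < length i" "k < length j" using i j' k by (auto simp: list_all2_lengthD)
    ultimately show "j = i" using j by (metis id_take_nth_drop)
  qed (use assms in simp)
  moreover have "i ! k < dims A ! k" using i k by (simp add: list_all2_conv_all_nth)
  moreover have "ivec (delete_nth k i) ?s < prod_list ?s" by (rule ivec_less[OF delete_nth_less[OF i]])
  ultimately show ?thesis by (simp add: unfolding_mat_def)
qed

end

theory Submission
  imports Defs "HOL-Combinatorics.Multiset_Permutations"
begin

text \<open>
  Each of the \<open>d!\<close> nonzero blocks of \<open>sym(A)\<close> contributes the same value to the form
  of \<open>sym(A)\<close> at \<open>x\<close>, namely the multilinear form \<open>F\<close> of \<open>A\<close> at \<open>(u_1, \<dots>, u_d)\<close>, so the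
  Rayleigh quotient is \<open>F / |x|^d\<close>. Since \<open>F = u_k \<bullet> A_(k) u~_k\<close> with \<open>u~_k\<close> independent
  of \<open>u_k\<close>, the \<open>k\<close>-th block of the gradient at a unit vector is \<open>A_(k) u~_k - d F u_k\<close>.
  If it vanishes, the inner product with \<open>u_k\<close> gives \<open>F = d F |u_k|^2\<close>. So either \<open>F = 0\<close>
  and every \<open>A_(k) u~_k\<close> is zero, or every \<open>|u_k|^2\<close> is \<open>1 / d\<close>.
\<close>

section \<open>Index blocks and stacked vectors\<close>

lemma block_start_0 [simp]: "block_start ns 0 = 0"
  by (simp add: block_start_def)

lemma block_start_Cons_Suc [simp]: "block_start (n # ns) (Suc b) = n + block_start ns b"
  by (simp add: block_start_def)

lemma block_decomp:
  assumes "c < sum_list ns"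
  obtains b l where "b < length ns" "l < ns ! b" "c = block_start ns b + l"
proof -
  have "\<exists>b l. b < length ns \<and> l < ns ! b \<and> c = block_start ns b + l"
    using assms
  proof (induction ns arbitrary: c)
    case (Cons n ns)
    show ?case
    proof (cases "c < n")
      case True
      then show ?thesis by (intro exI[of _ 0] exI[of _ c]) simp
    next
      case False
      then have "c - n < sum_list ns" using Cons.prems by simp
      from Cons.IH[OF this] obtain b l where
        "b < length ns" "l < ns ! b" "c - n = block_start ns b + l" by blast
      then show ?thesis using False by (intro exI[of _ "Suc b"] exI[of _ l]) simp
    qed
  qed simp
  then show thesis using that by blast
qed

lemma block_index_less:
  assumes "b < length ns" "l < ns ! b"
  shows "block_start ns b + l < sum_list ns"
  using assms block_start_Suc[of b ns] block_start_mono[of "Suc b" "length ns" ns]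
  by (simp add: block_start_def)

text \<open>The block of an index is recovered by \<open>block_of\<close>, after which the offset
  follows by cancellation.\<close>

lemma block_index_eq_iff:
  assumes "b < length ns" "l < ns ! b" "b' < length ns" "l' < ns ! b'"
  shows "block_start ns b + l = block_start ns b' + l' \<longleftrightarrow> b = b' \<and> l = l'"
  using assms by (metis block_of_eq add_left_cancel)

lemma dim_stack [simp]: "dim_vec (stack us) = sum_list (map dim_vec us)"
  by (induction us) (auto simp: stack_def)

lemma index_stack:
  "b < length us \<Longrightarrow> l < dim_vec (us ! b) \<Longrightarrow>
    stack us $ (block_start (map dim_vec us) b + l) = us ! b $ l"
proof (induction us arbitrary: b)
  case (Cons u us)
  have *: "stack (u # us) = u @\<^sub>v stack us" by (simp add: stack_def)
  show ?case
  proof (cases b)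
    case (Suc b')
    with Cons block_index_less[of b' "map dim_vec us" l] show ?thesis
      by (simp add: * add.assoc del: dim_stack) (simp add: index_append_vec)
  qed (use Cons in \<open>auto simp: *\<close>)
qed simp

lemma eq_stackI:
  assumes "dim_vec v = sum_list (map dim_vec us)"
    and "\<And>b l. b < length us \<Longrightarrow> l < dim_vec (us ! b) \<Longrightarrow>
      v $ (block_start (map dim_vec us) b + l) = us ! b $ l"
  shows "v = stack us"
proof (rule eq_vecI)
  fix c assume "c < dim_vec (stack us)"
  then have "c < sum_list (map dim_vec us)" by simp
  then obtain b l where "b < length (map dim_vec us)" "l < map dim_vec us ! b"
    "c = block_start (map dim_vec us) b + l" by (rule block_decomp)
  then show "v $ c = stack us $ c" using assms(2) by (simp add: index_stack)
qed (use assms in simp)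

text \<open>Moving one coordinate of \<open>x\<close> changes exactly one block \<open>u_k\<close>.
  This turns a partial derivative in \<open>x\<close> into a question about dependence on a single
  \<open>u_k\<close>, where multilinearity applies.\<close>

lemma stack_add_unit_vec:
  fixes us :: "real vec list" and t :: real
  assumes k: "k < length us" and r: "r < dim_vec (us ! k)"
  shows "stack us + t \<cdot>\<^sub>v unit_vec (dim_vec (stack us)) (block_start (map dim_vec us) k + r) =
    stack (us[k := us ! k + t \<cdot>\<^sub>v unit_vec (dim_vec (us ! k)) r])"
    (is "?v = stack ?us")
proof (rule eq_stackI)
  have dims: "map dim_vec ?us = map dim_vec us"
    using k by (auto intro!: nth_equalityI simp: nth_list_update)
  show "dim_vec ?v = sum_list (map dim_vec ?us)" unfolding dims by simp
  fix b l assume "b < length ?us" "l < dim_vec (?us ! b)"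
  then have b: "b < length us" and l: "l < dim_vec (us ! b)"
    using k by (auto simp: nth_list_update split: if_splits)
  have less: "block_start (map dim_vec us) b + l < sum_list (map dim_vec us)"
    "block_start (map dim_vec us) k + r < sum_list (map dim_vec us)"
    using b l k r by (auto intro!: block_index_less)
  have "block_start (map dim_vec us) b + l = block_start (map dim_vec us) k + r
      \<longleftrightarrow> b = k \<and> l = r"
    using b l k r by (intro block_index_eq_iff) auto
  then show "?v $ (block_start (map dim_vec ?us) b + l) = ?us ! b $ l"
    unfolding dims using less b l k r
    by (auto simp: index_stack unit_vec_def nth_list_update)
qed

section \<open>The form of the symmetric embedding\<close>

definition multilinear_form :: "tensor \<Rightarrow> real vec list \<Rightarrow> real" where
  "multilinear_form A us =
    (\<Sum>i\<in>index_range (dims A). entry A i * (\<Prod>k<tensor_order A. us ! k $ (i ! k)))"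

text \<open>Source of the factor \<open>d!\<close>, which cancels the normalisation in
  \<open>sym_rayleigh\<close>.\<close>

lemma card_is_permutation: "card {b. is_permutation d b} = fact d"
proof -
  have "length b = d" if "distinct b" "set b = {..<d}" for b
    using that distinct_card card_lessThan by metis
  then have "{b. is_permutation d b} = permutations_of_set {..<d}"
    by (auto simp: is_permutation_def permutations_of_set_def)
  then show ?thesis by simp
qed

lemma is_permutation_bij_betw:
  "is_permutation d b \<Longrightarrow> bij_betw ((!) b) {..<d} {..<d}"
  by (auto simp: is_permutation_def intro!: bij_betw_nth)

lemma is_permutation_nth_less: "is_permutation d b \<Longrightarrow> k < d \<Longrightarrow> b ! k < d"
  by (meson bij_betwE is_permutation_bij_betw lessThan_iff)

text \<open>All nonzero terms lie in blocks indexed by permutations, so they are parametrised by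
  pairs of a permutation \<open>b\<close> and an index \<open>j\<close> of \<open>A\<close>. The
  term of such a pair does not depend on \<open>b\<close>: permuting the modes only reorders the
  factors of the product.\<close>

lemma sum_sym_embed:
  assumes dims: "map dim_vec us = dims A"
  shows "(\<Sum>c\<in>index_range (dims (sym_embed A)).
      entry (sym_embed A) c * (\<Prod>k<tensor_order A. stack us $ (c ! k))) =
    fact (tensor_order A) * multilinear_form A us"
proof -
  define d where "d = tensor_order A"
  define ns where "ns = dims A"
  let ?s = "block_start ns"
  define g where "g c = entry (sym_embed A) c * (\<Prod>k<d. stack us $ (c ! k))" for c
  \<comment> \<open>The position \<open>h (b, j)\<close> has as its \<open>k\<close>-th coordinate
    the offset \<open>j ! (b ! k)\<close> inside block \<open>b ! k\<close>.\<close>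
  define h where "h = (\<lambda>(b, j). map (\<lambda>m. ?s m + j ! m) b)"
  define S where "S = {b. is_permutation d b} \<times> index_range ns"
  have len_ns: "length ns = d" by (simp add: ns_def d_def tensor_order_def)
  have len_us: "length us = d" using dims len_ns by (metis length_map ns_def)
  have dim_us: "dim_vec (us ! k) = ns ! k" if "k < d" for k
    using dims that len_us by (metis nth_map ns_def)
  have bl: "map (block_of ns) (h (b, j)) = b" if "(b, j) \<in> S" for b j
    using that is_permutation_nth_less[of d b] len_ns unfolding h_def S_def
    by (auto intro!: nth_equalityI block_of_eq
        simp: is_permutation_def index_range_def list_all2_conv_all_nth)
  have range: "index_range (dims (sym_embed A)) = {c. length c = d \<and> (\<forall>k<d. c ! k < sum_list ns)}"
    by (auto simp: sym_embed_def Let_def index_range_def list_all2_conv_all_nth ns_def d_def)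
  have inj: "inj_on h S"
  proof (rule inj_onI)
    fix p q assume p: "p \<in> S" and q: "q \<in> S" and eq: "h p = h q"
    obtain b j b' j' where [simp]: "p = (b, j)" "q = (b', j')" by fastforce
    have b: "b' = b" using bl p q eq by (metis \<open>p = (b, j)\<close> \<open>q = (b', j')\<close>)
    \<comment> \<open>Since \<open>b\<close> runs through every mode, the coordinates of
      \<open>h (b, j)\<close> reveal every entry of \<open>j\<close>.\<close>
    have "set b = {..<d}" using p by (simp add: S_def is_permutation_def)
    then have "j ! m = j' ! m" if "m < d" for m
      using that eq by (auto simp: h_def b)
    moreover have "length j = d" "length j' = d"
      using p q len_ns by (auto simp: S_def index_range_def list_all2_lengthD)
    ultimately show "p = q" using b by (auto intro: nth_equalityI)
  qed
  have sub: "h ` S \<subseteq> index_range (dims (sym_embed A))"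
  proof clarify
    fix b j assume S: "(b, j) \<in> S"
    then have perm: "is_permutation d b" by (simp add: S_def)
    have "length b = d" using perm by (simp add: is_permutation_def)
    moreover have "j ! m < ns ! m" if "m < d" for m
      using S that len_ns by (simp add: S_def index_range_def list_all2_conv_all_nth)
    ultimately show "h (b, j) \<in> index_range (dims (sym_embed A))"
      using is_permutation_nth_less[OF perm] len_ns unfolding range
      by (auto simp: h_def intro!: block_index_less)
  qed
  \<comment> \<open>Contrapositive: a nonzero term forces the block multi-index of \<open>c\<close>
    to be a permutation, and then a preimage of \<open>c\<close> under \<open>h\<close> can be
    built.\<close>
  have zero: "g c = 0" if c: "c \<in> index_range (dims (sym_embed A)) - h ` S" for c
  proof (rule ccontr)
    assume "g c \<noteq> 0"
    let ?b = "map (block_of ns) c"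
    have perm: "is_permutation d ?b"
      using \<open>g c \<noteq> 0\<close> by (auto simp: g_def sym_embed_def Let_def ns_def d_def split: if_splits)
    have len: "length c = d" using c range by simp
    have "\<exists>l. \<forall>k<d. l k < ns ! (?b ! k) \<and> c ! k = ?s (?b ! k) + l k"
    proof (rule exI, intro allI impI)
      fix k assume k: "k < d"
      then have "c ! k < sum_list ns" using c range by simp
      then obtain b l where bl': "b < length ns" "l < ns ! b" "c ! k = ?s b + l"
        by (rule block_decomp)
      then have "?b ! k = b" using len k by (simp add: block_of_eq)
      then show "c ! k - ?s (?b ! k) < ns ! (?b ! k) \<and>
          c ! k = ?s (?b ! k) + (c ! k - ?s (?b ! k))"
        using bl' by simp
    qed
    then obtain l where l: "\<And>k. k < d \<Longrightarrow> l k < ns ! (?b ! k) \<and> c ! k = ?s (?b ! k) + l k"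
      by blast
    \<comment> \<open>The offsets \<open>l\<close> are listed by position in \<open>c\<close>,
      whereas \<open>j\<close> must be listed by mode of \<open>A\<close>. The inverse permutation
      \<open>pos\<close> converts one listing into the other.\<close>
    define pos where "pos = inv_into {..<d} ((!) ?b)"
    have bij: "bij_betw ((!) ?b) {..<d} {..<d}" by (rule is_permutation_bij_betw[OF perm])
    have pos_nth: "pos m < d" "?b ! pos m = m" if "m < d" for m
      using bij that unfolding pos_def
      by (metis bij_betw_def f_inv_into_f inv_into_into lessThan_iff)+
    have pos_of_nth: "pos (?b ! k) = k" if "k < d" for k
      using bij that unfolding pos_def by (metis bij_betw_inv_into_left lessThan_iff)
    define j where "j = map (\<lambda>m. l (pos m)) [0..<d]"
    have "l (pos m) < ns ! m" if "m < d" for m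
      using l[OF pos_nth(1)[OF that]] unfolding pos_nth(2)[OF that] by simp
    then have "j \<in> index_range ns"
      using len_ns by (simp add: j_def index_range_def list_all2_conv_all_nth)
    then have "(?b, j) \<in> S" using perm by (simp add: S_def)
    moreover have "h (?b, j) = c"
    proof (rule nth_equalityI)
      fix k assume "k < length (h (?b, j))"
      then have k: "k < d" using len by (simp add: h_def)
      have "?b ! k < d" by (rule is_permutation_nth_less[OF perm k])
      then have "j ! (?b ! k) = l k" using pos_of_nth[OF k] by (simp add: j_def)
      moreover have "h (?b, j) ! k = ?s (?b ! k) + j ! (?b ! k)"
        using k len by (simp add: h_def)
      ultimately show "h (?b, j) ! k = c ! k" using l[OF k] by (elim conjE) (simp only:)
    qed (simp add: h_def)
    ultimately show False using c by (metis DiffD2 image_eqI)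
  qed
  have val: "g (h (b, j)) = entry A j * (\<Prod>k<d. us ! k $ (j ! k))" if S: "(b, j) \<in> S" for b j
  proof -
    have perm: "is_permutation d b" and j: "j \<in> index_range ns" using S by (auto simp: S_def)
    have lb: "length b = d" using perm by (simp add: is_permutation_def)
    have lj: "length j = d" using j len_ns by (simp add: index_range_def list_all2_lengthD)
    have jl: "j ! m < ns ! m" if "m < d" for m
      using that j lj by (simp add: index_range_def list_all2_conv_all_nth)
    have bless: "b ! k < d" if "k < d" for k using is_permutation_nth_less[OF perm that] .
    \<comment> \<open>This is the shape expected by \<open>entry_sym_embed\<close>; the offset list
      \<open>map ((!) j) b\<close> is also the index at which the transpose of \<open>A\<close> by
      \<open>b\<close> takes the value \<open>entry A j\<close>.\<close>
    have "h (b, j) = map2 (\<lambda>a m. ?s a + m) b (map ((!) j) b)"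
      unfolding h_def by (auto intro!: nth_equalityI)
    moreover have "entry (sym_embed A) (map2 (\<lambda>a m. block_start (dims A) a + m) b (map ((!) j) b)) =
        entry (tensor_transpose A b) (map ((!) j) b)"
      using perm lb bless jl
      by (subst entry_sym_embed)
        (auto simp: d_def ns_def index_range_def list_all2_conv_all_nth)
    ultimately have "entry (sym_embed A) (h (b, j)) = entry A j"
      using entry_tensor_transpose[OF perm lj] by (simp add: ns_def)
    moreover have "(\<Prod>k<d. stack us $ (h (b, j) ! k)) = (\<Prod>k<d. us ! (b ! k) $ (j ! (b ! k)))"
    proof (intro prod.cong refl)
      fix k assume "k \<in> {..<d}"
      then have k: "k < d" by simp
      have "stack us $ (block_start (map dim_vec us) (b ! k) + j ! (b ! k)) =
          us ! (b ! k) $ (j ! (b ! k))"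
        using bless[OF k] jl len_us dim_us by (intro index_stack) auto
      then show "stack us $ (h (b, j) ! k) = us ! (b ! k) $ (j ! (b ! k))"
        using k lb dims by (simp add: h_def ns_def)
    qed
    \<comment> \<open>Here the dependence on \<open>b\<close> disappears.\<close>
    moreover have "\<dots> = (\<Prod>k<d. us ! k $ (j ! k))"
      by (rule prod.reindex_bij_betw[OF is_permutation_bij_betw[OF perm]])
    ultimately show ?thesis by (simp add: g_def)
  qed
  have "(\<Sum>c\<in>index_range (dims (sym_embed A)). g c) = (\<Sum>c\<in>h ` S. g c)"
    by (intro sum.mono_neutral_right finite_index_range sub ballI zero)
  also have "\<dots> = (\<Sum>(b, j)\<in>S. entry A j * (\<Prod>k<d. us ! k $ (j ! k)))"
    by (subst sum.reindex[OF inj]) (auto intro!: sum.cong simp: val)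
  also have "\<dots> = fact d * multilinear_form A us"
    unfolding S_def by (subst sum.cartesian_product[symmetric])
      (simp add: card_is_permutation multilinear_form_def d_def ns_def)
  finally show ?thesis by (simp add: g_def d_def)
qed

lemma sym_rayleigh_stack:
  assumes "map dim_vec us = dims A"
  shows "sym_rayleigh A (stack us) = multilinear_form A us / norm2 (stack us) ^ tensor_order A"
  using sum_sym_embed[OF assms] by (simp add: sym_rayleigh_def Let_def)

section \<open>Entries of iterated Kronecker products\<close>

lemma dim_foldr_kron_rev:
  "dim_vec (foldr kron (rev vs) w) = prod_list (map dim_vec vs) * dim_vec w"
  by (induction vs arbitrary: w) (simp_all add: kron_def)

text \<open>The accumulator \<open>w\<close> stands for the part of the product already processed; its index
  \<open>p\<close> is the least significant digit.\<close>

lemma index_foldr_kron_rev: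
  assumes "list_all2 (<) i (map dim_vec vs)" "p < dim_vec w"
  shows "foldr kron (rev vs) w $ (p + dim_vec w * ivec i (map dim_vec vs)) =
    w $ p * prod_list (map2 ($) vs i)"
  using assms
proof (induction vs arbitrary: i p w)
  case Nil
  then show ?case by (simp add: ivec_def)
next
  case (Cons v vs)
  then obtain a i' where i: "i = a # i'" "a < dim_vec v" "list_all2 (<) i' (map dim_vec vs)"
    by (auto simp: list_all2_Cons2)
  have dim: "dim_vec (kron v w) = dim_vec w * dim_vec v" by (simp add: kron_def)
  \<comment> \<open>The two lowest digits \<open>p\<close> and \<open>a\<close> merge into one valid
    index of \<open>kron v w\<close>, the accumulator for the remaining vectors.\<close>
  have "p + dim_vec w * a < dim_vec w * Suc a" using Cons.prems by simp
  also have "\<dots> \<le> dim_vec w * dim_vec v" using i by (intro mult_le_mono2) simp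
  finally have less: "p + dim_vec w * a < dim_vec w * dim_vec v" .
  moreover have "(p + dim_vec w * a) div dim_vec w = a" "(p + dim_vec w * a) mod dim_vec w = p"
    using Cons.prems by (auto simp: div_add1_eq)
  ultimately have idx: "kron v w $ (p + dim_vec w * a) = v $ a * w $ p"
    by (simp add: kron_def mult.commute[of "dim_vec v"])
  have "foldr kron (rev vs) (kron v w) $
      ((p + dim_vec w * a) + dim_vec (kron v w) * ivec i' (map dim_vec vs)) =
      kron v w $ (p + dim_vec w * a) * prod_list (map2 ($) vs i')"
    using less by (intro Cons.IH i) (simp add: dim)
  then show ?case unfolding idx dim by (simp add: i ivec_Cons algebra_simps)
qed

lemma map_delete_nth: "map f (delete_nth k xs) = delete_nth k (map f xs)"
  by (simp add: delete_nth_def take_map drop_map)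

lemma dim_kron_except: "dim_vec (kron_except us k) = prod_list (delete_nth k (map dim_vec us))"
  by (simp add: kron_except_def dim_foldr_kron_rev map_delete_nth)

lemma index_kron_except:
  assumes "list_all2 (<) i (map dim_vec us)"
  shows "kron_except us k $ ivec (delete_nth k i) (delete_nth k (map dim_vec us)) =
    prod_list (map2 ($) (delete_nth k us) (delete_nth k i))"
  \<comment> \<open>The initial accumulator has dimension 1, so its only digit is 0 and it
    contributes the factor 1.\<close>
  using index_foldr_kron_rev[of "delete_nth k i" "delete_nth k us" 0 "vec 1 (\<lambda>_. 1)"]
    delete_nth_less[OF assms, of k]
  by (simp add: kron_except_def map_delete_nth)

section \<open>Unfoldings and the multilinear form\<close>

lemma prod_split_mode:
  fixes us :: "real vec list"
  assumes "length i = length us" "k < length us"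
  shows "(\<Prod>m<length us. us ! m $ (i ! m)) =
    us ! k $ (i ! k) * prod_list (map2 ($) (delete_nth k us) (delete_nth k i))"
proof -
  have "us = take k us @ us ! k # drop (Suc k) us" "i = take k i @ i ! k # drop (Suc k) i"
    using assms by (simp_all add: id_take_nth_drop)
  then have "zip us i = zip (take k us) (take k i) @ (us ! k, i ! k) #
      zip (drop (Suc k) us) (drop (Suc k) i)"
    using assms by (metis length_take zip_Cons_Cons zip_append)
  moreover have "(\<Prod>m<length us. us ! m $ (i ! m)) = prod_list (map2 ($) us i)"
    using assms by (simp add: prod.list_conv_set_nth lessThan_atLeast0)
  ultimately show ?thesis
    using assms by (simp add: delete_nth_def)
qed

text \<open>Mixed-radix expansion: the lowest digit is the remainder modulo the first dimension, and
  the quotient supplies the other digits.\<close>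

lemma ivec_surj:
  assumes "c < prod_list s"
  obtains i where "list_all2 (<) i s" "ivec i s = c"
proof -
  have "\<exists>i. list_all2 (<) i s \<and> ivec i s = c"
    using assms
  proof (induction s arbitrary: c)
    case Nil
    then show ?case by (simp add: ivec_def)
  next
    case (Cons n s)
    \<comment> \<open>A zero dimension would make the product zero, contradicting the bound on
      \<open>c\<close>; positivity makes \<open>c mod n\<close> a legal digit.\<close>
    then have n: "0 < n" by (cases n) auto
    have "c div n < prod_list s"
      using Cons.prems by (simp add: less_mult_imp_div_less mult.commute)
    from Cons.IH[OF this] obtain i where "list_all2 (<) i s" "ivec i s = c div n" by blast
    then show ?case using n by (intro exI[of _ "(c mod n) # i"]) (simp add: ivec_Cons)
  qed
  then show thesis using that by blast
qed

text \<open>Allows a sum along row \<open>r\<close> of the unfolding to be rewritten as a sum over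
  the multi-indices whose \<open>k\<close>-th entry is \<open>r\<close>.\<close>

lemma bij_betw_unfolding_column:
  assumes k: "k < length ns" and r: "r < ns ! k"
  shows "bij_betw (\<lambda>i. ivec (delete_nth k i) (delete_nth k ns))
    {i \<in> index_range ns. i ! k = r} {0..<prod_list (delete_nth k ns)}"
  unfolding bij_betw_def
proof (intro conjI inj_onI equalityI subsetI)
  fix i j
  assume i: "i \<in> {i \<in> index_range ns. i ! k = r}" and j: "j \<in> {i \<in> index_range ns. i ! k = r}"
    and eq: "ivec (delete_nth k i) (delete_nth k ns) = ivec (delete_nth k j) (delete_nth k ns)"
  have i': "list_all2 (<) i ns" and j': "list_all2 (<) j ns"
    using i j by (auto simp: index_range_def)
  then have len: "length i = length ns" "length j = length ns" by (auto simp: list_all2_lengthD)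
  have "delete_nth k i = delete_nth k j"
    using ivec_inj[OF delete_nth_less[OF i'] delete_nth_less[OF j'] eq] .
  then have "take k i = take k j" "drop (Suc k) i = drop (Suc k) j"
    using len by (simp_all add: delete_nth_def)
  then show "i = j" using i j k len by (metis (mono_tags, lifting) id_take_nth_drop mem_Collect_eq)
next
  fix c assume "c \<in> (\<lambda>i. ivec (delete_nth k i) (delete_nth k ns)) ` {i \<in> index_range ns. i ! k = r}"
  then show "c \<in> {0..<prod_list (delete_nth k ns)}"
    by (auto simp: index_range_def intro!: ivec_less delete_nth_less)
next
  fix c assume "c \<in> {0..<prod_list (delete_nth k ns)}"
  then have "c < prod_list (delete_nth k ns)" by simp
  then obtain i where i: "list_all2 (<) i (delete_nth k ns)" "ivec i (delete_nth k ns) = c"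
    by (rule ivec_surj)
  \<comment> \<open>The preimage of the column reinserts \<open>r\<close> at the deleted
    position.\<close>
  define j where "j = take k i @ r # drop k i"
  have len: "length i = length ns - 1"
    using i k by (simp add: list_all2_lengthD delete_nth_def)
  have take: "list_all2 (<) (take k i) (take k ns)"
    using list_all2_takeI[OF i(1), of k] k by (simp add: delete_nth_def)
  have drop: "list_all2 (<) (drop k i) (drop (Suc k) ns)"
    using list_all2_dropI[OF i(1), of k] k by (simp add: delete_nth_def)
  have "list_all2 (<) j (take k ns @ ns ! k # drop (Suc k) ns)"
    unfolding j_def using take drop r by (intro list_all2_appendI) auto
  then have "j \<in> index_range ns"
    using k by (simp add: index_range_def id_take_nth_drop[symmetric])
  moreover have "j ! k = r" "delete_nth k j = i"
    using len k by (simp_all add: j_def delete_nth_def nth_append min_def)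
  ultimately show "c \<in> (\<lambda>i. ivec (delete_nth k i) (delete_nth k ns)) ` {i \<in> index_range ns. i ! k = r}"
    using i by force
qed

lemma index_unfolding_mult_kron:
  assumes dims: "map dim_vec us = dims A" and k: "k < tensor_order A" and r: "r < dims A ! k"
  shows "(unfolding_mat A k *\<^sub>v kron_except us k) $ r =
    (\<Sum>i\<in>{i \<in> index_range (dims A). i ! k = r}.
      entry A i * prod_list (map2 ($) (delete_nth k us) (delete_nth k i)))"
proof -
  let ?s = "delete_nth k (dims A)"
  have dim: "dim_row (unfolding_mat A k) = dims A ! k" "dim_col (unfolding_mat A k) = prod_list ?s"
    by (simp_all add: unfolding_mat_def)
  have "(unfolding_mat A k *\<^sub>v kron_except us k) $ r =
      (\<Sum>c\<in>{0..<prod_list ?s}. unfolding_mat A k $$ (r, c) * kron_except us k $ c)"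
    using r dim by (simp add: scalar_prod_def dim_kron_except dims)
  also have "\<dots> = (\<Sum>i\<in>{i \<in> index_range (dims A). i ! k = r}.
      unfolding_mat A k $$ (r, ivec (delete_nth k i) ?s) *
      kron_except us k $ ivec (delete_nth k i) ?s)"
    using k r by (intro sum.reindex_bij_betw[symmetric] bij_betw_unfolding_column)
      (auto simp: tensor_order_def)
  also have "\<dots> = (\<Sum>i\<in>{i \<in> index_range (dims A). i ! k = r}.
      entry A i * prod_list (map2 ($) (delete_nth k us) (delete_nth k i)))"
  proof (intro sum.cong refl)
    fix i assume i: "i \<in> {i \<in> index_range (dims A). i ! k = r}"
    have "unfolding_mat A k $$ (r, ivec (delete_nth k i) ?s) = entry A i"
      using index_unfolding[of i A k] i k by simp
    moreover have "kron_except us k $ ivec (delete_nth k i) ?s =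
        prod_list (map2 ($) (delete_nth k us) (delete_nth k i))"
      using index_kron_except[of i us k] i by (simp add: dims index_range_def)
    ultimately show "unfolding_mat A k $$ (r, ivec (delete_nth k i) ?s) *
        kron_except us k $ ivec (delete_nth k i) ?s =
        entry A i * prod_list (map2 ($) (delete_nth k us) (delete_nth k i))" by simp
  qed
  finally show ?thesis .
qed

text \<open>Grouping the terms by the value \<open>r\<close> of the \<open>k\<close>-th index, the
  factor \<open>us ! k $ r\<close> comes out and the rest is component \<open>r\<close> of the
  matrix-vector product. This displays the form as linear in \<open>u_k\<close>, because
  \<open>kron_except us k\<close> omits that vector.\<close>

lemma multilinear_form_mode:
  assumes dims: "map dim_vec us = dims A" and k: "k < tensor_order A"
  shows "multilinear_form A us = us ! k \<bullet> (unfolding_mat A k *\<^sub>v kron_except us k)"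
proof -
  let ?P = "\<lambda>i. prod_list (map2 ($) (delete_nth k us) (delete_nth k i))"
  have len: "length us = tensor_order A" using dims by (metis length_map tensor_order_def)
  have kl: "i ! k < dims A ! k" if "i \<in> index_range (dims A)" for i
    using that k by (auto simp: index_range_def list_all2_conv_all_nth tensor_order_def)
  have "multilinear_form A us = (\<Sum>i\<in>index_range (dims A). us ! k $ (i ! k) * (entry A i * ?P i))"
    unfolding multilinear_form_def
  proof (intro sum.cong refl)
    fix i assume "i \<in> index_range (dims A)"
    then have "length i = length us"
      using len by (simp add: index_range_def list_all2_lengthD tensor_order_def)
    then show "entry A i * (\<Prod>k<tensor_order A. us ! k $ (i ! k)) =
        us ! k $ (i ! k) * (entry A i * ?P i)"
      using prod_split_mode[of i us k] k len by simp
  qed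
  also have "\<dots> = (\<Sum>r\<in>{0..<dims A ! k}. \<Sum>i\<in>{i \<in> index_range (dims A). i ! k = r}.
      us ! k $ (i ! k) * (entry A i * ?P i))"
    using kl by (intro sum.group[symmetric]) (auto simp: finite_index_range)
  also have "\<dots> = (\<Sum>r\<in>{0..<dims A ! k}. us ! k $ r * (unfolding_mat A k *\<^sub>v kron_except us k) $ r)"
    by (intro sum.cong refl)
      (simp add: index_unfolding_mult_kron[OF dims k] sum_distrib_left del: index_mult_mat_vec)
  also have "\<dots> = us ! k \<bullet> (unfolding_mat A k *\<^sub>v kron_except us k)"
    by (simp add: scalar_prod_def unfolding_mat_def)
  finally show ?thesis .
qed

section \<open>Partial derivatives of the Rayleigh quotient\<close>

lemma delete_nth_list_update [simp]: "delete_nth k (xs[k := y]) = delete_nth k xs"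
  by (simp add: delete_nth_def)

lemma kron_except_list_update [simp]: "kron_except (us[k := v]) k = kron_except us k"
  by (simp add: kron_except_def)

lemma norm2_add_unit_vec:
  assumes "x \<in> carrier_vec n" "j < n"
  shows "norm2 (x + t \<cdot>\<^sub>v unit_vec n j) = sqrt (x \<bullet> x + 2 * t * x $ j + t\<^sup>2)"
proof -
  have "(x + t \<cdot>\<^sub>v unit_vec n j) \<bullet> (x + t \<cdot>\<^sub>v unit_vec n j) = x \<bullet> x + 2 * t * x $ j + t\<^sup>2"
    using assms
    by (simp add: scalar_prod_add_distrib[of _ n] add_scalar_prod_distrib[of _ n]
        power2_eq_square algebra_simps)
  then show ?thesis by (simp add: norm2_def)
qed

text \<open>Along a coordinate line the numerator is affine in \<open>t\<close> and the squared norm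
  is quadratic, so the quotient has a closed form. The quotient rule at \<open>t = 0\<close> is then
  simple because the norm there is 1.\<close>

lemma sym_rayleigh_deriv:
  assumes dims: "map dim_vec us = dims A" and k: "k < tensor_order A" and r: "r < dims A ! k"
    and unit: "stack us \<bullet> stack us = 1"
  shows "((\<lambda>t. sym_rayleigh A (stack us + t \<cdot>\<^sub>v
        unit_vec (dim_vec (stack us)) (block_start (dims A) k + r))) has_real_derivative
      (unfolding_mat A k *\<^sub>v kron_except us k) $ r -
      real (tensor_order A) * multilinear_form A us * us ! k $ r) (at 0)"
proof -
  let ?w = "unfolding_mat A k *\<^sub>v kron_except us k"
  let ?F = "multilinear_form A us" and ?a = "us ! k $ r" and ?d = "tensor_order A"
  let ?u = "\<lambda>t. us ! k + t \<cdot>\<^sub>v unit_vec (dims A ! k) r"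
  have len: "length us = ?d" using dims by (metis length_map tensor_order_def)
  have dim: "dim_vec (us ! k) = dims A ! k" using dims k len by (metis nth_map)
  have w: "?w \<in> carrier_vec (dims A ! k)" by (auto simp: unfolding_mat_def intro!: carrier_vecI)
  have j: "block_start (dims A) k + r < dim_vec (stack us)"
    using k r dims by (simp add: block_index_less tensor_order_def)
  have xj: "stack us $ (block_start (dims A) k + r) = ?a"
    using index_stack[of k us r] k r len dim dims by simp
  have eq: "sym_rayleigh A (stack us + t \<cdot>\<^sub>v
        unit_vec (dim_vec (stack us)) (block_start (dims A) k + r)) =
      (?F + t * ?w $ r) / sqrt (1 + 2 * t * ?a + t\<^sup>2) ^ ?d" for t
  proof -
    have st: "stack us + t \<cdot>\<^sub>v unit_vec (dim_vec (stack us)) (block_start (dims A) k + r) =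
        stack (us[k := ?u t])"
      using stack_add_unit_vec[of k us r t] k r len dim dims by simp
    have dims': "map dim_vec (us[k := ?u t]) = dims A"
      using dims dim k len by (auto intro!: nth_equalityI simp: map_update)
    \<comment> \<open>By \<open>kron_except_list_update\<close>, the coefficient vector
      \<open>?w\<close> stays fixed while mode \<open>k\<close> is perturbed.\<close>
    have "multilinear_form A (us[k := ?u t]) = ?u t \<bullet> ?w"
      using multilinear_form_mode[OF dims' k] k len by simp
    also have "\<dots> = us ! k \<bullet> ?w + t * ?w $ r"
      using w r dim carrier_vecI[OF dim]
      by (simp add: add_scalar_prod_distrib[of _ "dims A ! k"]
          smult_scalar_prod_distrib[of _ "dims A ! k"] scalar_prod_left_unit
          del: index_mult_mat_vec)
    also have "us ! k \<bullet> ?w = ?F" using multilinear_form_mode[OF dims k] by simp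
    finally have "multilinear_form A (us[k := ?u t]) = ?F + t * ?w $ r" .
    moreover have "norm2 (stack (us[k := ?u t])) = sqrt (1 + 2 * t * ?a + t\<^sup>2)"
      using norm2_add_unit_vec[OF carrier_vecI[OF refl] j, of t] unfolding st unit xj .
    ultimately show ?thesis unfolding st sym_rayleigh_stack[OF dims'] by simp
  qed
  \<comment> \<open>At \<open>t = 0\<close> the radicand is 1, so the root is differentiable there
    with derivative \<open>2 * ?a / 2\<close>.\<close>
  have "((\<lambda>t. sqrt (1 + 2 * t * ?a + t\<^sup>2)) has_real_derivative ?a) (at 0)"
    by (auto intro!: derivative_eq_intros)
  from DERIV_power[OF this, of ?d]
  have denom: "((\<lambda>t. sqrt (1 + 2 * t * ?a + t\<^sup>2) ^ ?d) has_real_derivative real ?d * ?a) (at 0)"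
    by (simp add: mult_ac)
  have num: "((\<lambda>t. ?F + t * ?w $ r) has_real_derivative ?w $ r) (at 0)"
    by (auto intro!: derivative_eq_intros)
  have "((\<lambda>t. (?F + t * ?w $ r) / sqrt (1 + 2 * t * ?a + t\<^sup>2) ^ ?d)
      has_real_derivative ?w $ r - real ?d * ?F * ?a) (at 0)"
    by (rule DERIV_cong[OF DERIV_divide[OF num denom]]) (simp_all add: mult_ac)
  then show ?thesis unfolding eq .
qed

section \<open>Unit critical points\<close>

theorem corollary4p6:
  fixes A :: tensor and us :: "real vec list" and x :: "real vec" and d N :: nat
  assumes "d = tensor_order A"
    and "N = sum_list (dims A)"
    and "x \<in> carrier_vec N"
    and "x = stack us"
    and "length us = d"
    and "\<forall>k<d. us ! k \<in> carrier_vec (dims A ! k)"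
    and "has_gradient (sym_rayleigh A) (0\<^sub>v N) x"
    and "x \<bullet> x = 1"
  shows "(\<forall>k<d. unfolding_mat A k *\<^sub>v kron_except us k = 0\<^sub>v (dims A ! k)) \<or>
    (stack (map (\<lambda>k. unfolding_mat A k *\<^sub>v kron_except us k) [0..<d]) =
       (real d * sym_rayleigh A x) \<cdot>\<^sub>v stack us \<and>
     (\<forall>k<d. norm2 (us ! k) = 1 / sqrt (real d)))"
proof -
  let ?w = "\<lambda>k. unfolding_mat A k *\<^sub>v kron_except us k"
  define F where "F = multilinear_form A us"
  have dims: "map dim_vec us = dims A"
    using assms(1,5,6) by (auto intro!: nth_equalityI simp: tensor_order_def)
  have unit: "stack us \<bullet> stack us = 1" using assms(4,8) by simp
  have carr: "us ! k \<in> carrier_vec (dims A ! k)" if "k < d" for k using assms(6) that by blast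
  have wdim: "dim_vec (?w k) = dims A ! k" for k by (simp add: unfolding_mat_def)
  have F: "sym_rayleigh A x = F"
    using sym_rayleigh_stack[OF dims] unit by (simp add: F_def assms(4) norm2_def)
  have w: "?w k = (real d * F) \<cdot>\<^sub>v us ! k" if k: "k < d" for k
  proof (rule eq_vecI)
    fix r assume "r < dim_vec ((real d * F) \<cdot>\<^sub>v us ! k)"
    then have r: "r < dims A ! k" using carr[OF k] by simp
    have j: "block_start (dims A) k + r < N"
      using k r assms(1,2) by (simp add: block_index_less tensor_order_def)
    have "((\<lambda>t. sym_rayleigh A (x + t \<cdot>\<^sub>v unit_vec (dim_vec x) (block_start (dims A) k + r)))
        has_real_derivative 0) (at 0)"
      using assms(3,7) j by (auto simp: has_gradient_def)
    \<comment> \<open>The vanishing partial derivative and the computed one must agree, which is the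
      block equation in component \<open>r\<close>.\<close>
    from DERIV_unique[OF this[unfolded assms(4)]
        sym_rayleigh_deriv[OF dims k[unfolded assms(1)] r unit]]
    show "?w k $ r = ((real d * F) \<cdot>\<^sub>v us ! k) $ r"
      using r carr[OF k] by (simp add: F_def assms(1) del: index_mult_mat_vec)
  qed (use carr[OF k] wdim in simp)
  show ?thesis
  proof (cases "F = 0")
    case True
    have "?w k = 0\<^sub>v (dims A ! k)" if k: "k < d" for k
      unfolding w[OF k] True using carr[OF k] by (intro eq_vecI) simp_all
    then show ?thesis by blast
  next
    case False
    have "norm2 (us ! k) = 1 / sqrt (real d)" if k: "k < d" for k
    proof -
      have "F = us ! k \<bullet> ?w k"
        using multilinear_form_mode[OF dims] k assms(1) by (simp add: F_def)
      also have "\<dots> = real d * F * (us ! k \<bullet> us ! k)"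
        unfolding w[OF k] using carr[OF k] by simp
      \<comment> \<open>Cancelling \<open>F\<close> uses \<open>F \<noteq> 0\<close>, and dividing
        by \<open>d\<close> is legitimate because \<open>k < d\<close> gives
        \<open>d > 0\<close>.\<close>
      finally have "us ! k \<bullet> us ! k = 1 / real d" using False k by (simp add: field_simps)
      then show ?thesis by (simp add: norm2_def real_sqrt_divide)
    qed
    \<comment> \<open>The block equations \<open>w\<close> are glued together: both sides are
      compared entry by entry in each block.\<close>
    moreover have "(real d * F) \<cdot>\<^sub>v stack us = stack (map ?w [0..<d])"
    proof (rule eq_stackI)
      have dims': "map dim_vec (map ?w [0..<d]) = map dim_vec us"
        using dims wdim assms(1,5) by (auto intro!: nth_equalityI simp: tensor_order_def)
      show "dim_vec ((real d * F) \<cdot>\<^sub>v stack us) = sum_list (map dim_vec (map ?w [0..<d]))"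
        unfolding dims' by simp
      fix b l assume b: "b < length (map ?w [0..<d])" and "l < dim_vec (map ?w [0..<d] ! b)"
      then have l: "l < dim_vec (us ! b)" using wdim carr[of b] by simp
      have "block_start (map dim_vec us) b + l < sum_list (map dim_vec us)"
        using b l assms(5) by (intro block_index_less) auto
      then show "((real d * F) \<cdot>\<^sub>v stack us) $ (block_start (map dim_vec (map ?w [0..<d])) b + l) =
          map ?w [0..<d] ! b $ l"
        unfolding dims' using b l assms(5) w by (simp add: index_stack del: index_mult_mat_vec)
    qed
    ultimately show ?thesis unfolding F by simp
  qed
qed

end
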